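(* Let $n$ and $l$ be positive integers. The height of the set of all words over an ordered alphabet of cardinality $l$ that are not $n$-divisible, relative to the set of words of length less than $n$, does not exceed $$\Phi(n,l) = 2^{40}\, l\cdot n^{38+8\log_2 n}.$$
   Context: The alphabet $a_1\prec a_2\prec\dots\prec a_l$ is linearly ordered, and words are compared lexicographically; two words are incomparable if one of them is a beginning (prefix) of the other. Thus $u\succ v$ means that neither word is a prefix of the other and, at the first position where they differ, the letter of $u$ is greater than that of $v$. A word $W$ is $n$-divisible if it can be represented as a concatenation $W=vu_1u_2\cdots u_n$ with $u_1\succ u_2\succ\dots\succ u_n$. A set $M$ of words has height $h$ over a set of words $Y$ if $h$ is the minimal integer such that every word of $M$ can be represented as $u_{1}^{k_1}u_{2}^{k_2}\cdots u_{r}^{k_r}$ with all $u_{i}\in Y$ and $r\leqslant h$. *)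

theory Defs
  imports Complex_Main
begin

text \<open>
  The first disagreement is strictly inside both words, so a word and its prefixes are incomparable
  (unlike in \<^const>\<open>lexord\<close>, where a proper prefix is smaller).
\<close>
definition word_greater :: "'a::linorder list \<Rightarrow> 'a list \<Rightarrow> bool" (infix "\<succ>" 50) where
  "u \<succ> v \<longleftrightarrow> (\<exists>p a b s t. u = p @ a # s \<and> v = p @ b # t \<and> b < a)"

text \<open>
  The word \<open>v\<close> may be empty. For \<open>n \<ge> 2\<close> the words \<open>u\<^sub>i\<close> are nonempty because the
  empty word is incomparable to every word.
\<close>
definition n_divisible :: "nat \<Rightarrow> 'a::linorder list \<Rightarrow> bool" where
  "n_divisible n W \<longleftrightarrow>
     (\<exists>v us. length us = n \<and> W = v @ concat us \<and> successively (\<succ>) us)"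

definition word_power :: "'a list \<Rightarrow> nat \<Rightarrow> 'a list" where
  "word_power u k = concat (replicate k u)"

text \<open>
  The list \<open>ps\<close> holds the pairs \<open>(u\<^sub>i, k\<^sub>i)\<close> and its length is \<open>r\<close>. Factors with
  \<open>k\<^sub>i = 0\<close> can be dropped, so allowing them does not affect the height.
\<close>
definition representable :: "'a list set \<Rightarrow> nat \<Rightarrow> 'a list \<Rightarrow> bool" where
  "representable Y h W \<longleftrightarrow>
     (\<exists>ps. length ps \<le> h \<and> (\<forall>(u, k) \<in> set ps. u \<in> Y) \<and>
           W = concat (map (\<lambda>(u, k). word_power u k) ps))"

definition has_height :: "'a list set \<Rightarrow> 'a list set \<Rightarrow> nat \<Rightarrow> bool" where
  "has_height M Y h \<longleftrightarrow>
     (\<forall>W\<in>M. representable Y h W) \<and>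
     (\<forall>h'. (\<forall>W\<in>M. representable Y h' W) \<longrightarrow> h \<le> h')"

definition \<Phi> :: "nat \<Rightarrow> nat \<Rightarrow> real" where
  "\<Phi> n l = 2 ^ 40 * real l * real n powr (38 + 8 * log 2 (real n))"

end

theory Submission
  imports Defs
begin

text \<open>
  The proof controls, for a word \<open>W\<close> that is not \<open>n\<close>-divisible, the number \<open>D k\<close> of distinct
  factors (``windows'') of length \<open>k\<close> in \<open>W\<close>, for \<open>k = 1, 2, 4, \<dots>\<close>, until \<open>k\<close> reaches \<open>n\<close>.

  Disjoint windows that descend lexicographically from left to right cut \<open>W\<close> into an
  \<open>n\<close>-division as soon as there are \<open>n\<close> of them. Ranking every position by the longest
  descending chain that starts there therefore uses fewer than \<open>n\<close> ranks (the idea of Mirsky's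
  theorem), and among positions of equal rank the windows weakly increase, as long as
  they do not overlap. Hence, between the first and the last occurrence of a window \<open>x\<close> with rank
  \<open>t\<close>, and at least \<open>k\<close> away from these two occurrences, rank \<open>t\<close> occurs with the window \<open>x\<close> only.
  The \<open>k\<close> positions from every such first occurrence on, and the \<open>k\<close> positions up to every such last
  occurrence, form a set (the fringe) of at most \<open>2 * k * (n - 1) * D k\<close> elements, and in
  every interval that avoids it the rank determines the window (\<open>window_eq_in_gap\<close>). So such a gap contains at most \<open>n - 1\<close> windows.

  This has two consequences. A window of length \<open>2 * k\<close> is a pair of windows of length \<open>k\<close>; it
  either lies near the fringe, or is determined by a gap and two ranks. Thus \<open>D (2 * k)\<close> is at
  most \<open>n ^ 6 * D k\<close> if \<open>2 \<le> n\<close> and \<open>k \<le> n\<close> (\<open>complexity_double\<close>, \<open>complexity_power_two\<close>), and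
  with \<open>D 1 \<le> l\<close> about \<open>log 2 n\<close> doublings give \<open>D k \<le> l * n ^ (6 * log 2 n + 6)\<close> for some \<open>k \<ge> n\<close>. At this final
  scale a gap has fewer distinct windows than their length, so, as in the theorem of Morse and
  Hedlund, it is periodic with a period below \<open>n\<close>, up to fewer than \<open>n\<close> letters
  (\<open>few_windows_imp_periodic\<close>). A gap thus costs at most \<open>n - 1\<close> factors, a position of the fringe
  costs one, and the exponents add up to less than \<open>38 + 8 * log 2 n\<close>.
\<close>

section \<open>Comparison of words\<close>

lemma word_greater_append:
  assumes "u \<succ> v"
  shows "u @ x \<succ> v @ y"
  using assms unfolding word_greater_def by (metis append.assoc append_Cons)

lemma word_greater_total:
  assumes "length u = length v" and "u \<noteq> v"
  shows "u \<succ> v \<or> v \<succ> u"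
proof -
  obtain p a s b t where "a \<noteq> b" "u = p @ a # s" "v = p @ b # t"
    using same_length_different[OF assms(2,1)] by auto
  then show ?thesis
    unfolding word_greater_def by (metis linorder_neq_iff)
qed

section \<open>Counting images\<close>

text \<open>
  If \<open>key x\<close> determines \<open>f x\<close>, then \<open>f\<close> has no more values than \<open>key\<close>. By symmetry it is enough
  to compare \<open>x \<le> y\<close>.
\<close>
lemma card_image_le_card_key:
  fixes A :: "'b::linorder set"
  assumes "finite A"
    and eq: "\<And>x y. x \<in> A \<Longrightarrow> y \<in> A \<Longrightarrow> x \<le> y \<Longrightarrow> key x = key y \<Longrightarrow> f x = f y"
  shows "card (f ` A) \<le> card (key ` A)"
proof (rule surj_card_le)
  define pick where "pick r = (SOME y. y \<in> A \<and> key y = r)" for r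
  show "f ` A \<subseteq> (\<lambda>r. f (pick r)) ` key ` A"
  proof (rule image_subsetI)
    fix x assume x: "x \<in> A"
    then have pick: "pick (key x) \<in> A" "key (pick (key x)) = key x"
      using someI[of "\<lambda>y. y \<in> A \<and> key y = key x" x] by (auto simp: pick_def)
    have "f x = f (pick (key x))"
      using eq[OF x pick(1)] eq[OF pick(1) x] pick(2) by (metis linorder_le_cases)
    then show "f x \<in> (\<lambda>r. f (pick r)) ` key ` A"
      using x by (intro image_eqI[of _ _ "key x"] imageI)
  qed
qed (use assms(1) in simp)

section \<open>Windows and descending chains of windows\<close>

definition window :: "'a list \<Rightarrow> nat \<Rightarrow> nat \<Rightarrow> 'a list" where
  "window W k i = take k (drop i W)"

definition starts :: "'a list \<Rightarrow> nat \<Rightarrow> nat set" where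
  "starts W k = {i. i + k \<le> length W}"

definition complexity :: "'a list \<Rightarrow> nat \<Rightarrow> nat" where
  "complexity W k = card (window W k ` starts W k)"

lemma finite_starts [simp]: "finite (starts W k)"
  by (rule finite_subset[of _ "{..length W}"]) (auto simp: starts_def)

lemma length_window: "i \<in> starts W k \<Longrightarrow> length (window W k i) = k"
  by (auto simp: window_def starts_def)

lemma window_add: "window W (k + m) i = window W k i @ window W m (i + k)"
  by (simp add: window_def take_add add.commute)

locale indivisible_word =
  fixes W :: "'a::linorder list" and n k :: nat
  assumes indivisible: "\<not> n_divisible n W" and n_pos: "0 < n" and k_pos: "0 < k"
begin

text \<open>
  A chain with \<open>m\<close> steps has \<open>m + 1\<close> windows. It is built from its leftmost window, because the
  division that it yields is a division of the suffix \<open>drop i W\<close>.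
\<close>
primrec descent :: "nat \<Rightarrow> nat \<Rightarrow> bool" where
  "descent 0 i \<longleftrightarrow> i \<in> starts W k"
| "descent (Suc m) i \<longleftrightarrow> i \<in> starts W k \<and>
     (\<exists>j. i + k \<le> j \<and> window W k i \<succ> window W k j \<and> descent m j)"

lemma descent_starts: "descent m i \<Longrightarrow> i \<in> starts W k"
  by (cases m) auto

text \<open>
  Cutting the suffix at the starts of the windows gives factors that begin with
  these windows, since consecutive starts are at least \<open>k\<close> apart; the windows already decide the
  comparison of neighbouring factors.
\<close>
lemma descent_division:
  assumes "descent m i"
  shows "\<exists>us. length us = Suc m \<and> drop i W = concat us \<and> successively (\<succ>) us \<and>
           (\<exists>s. hd us = window W k i @ s)"
  using assms
proof (induction m arbitrary: i)
  case 0
  have "drop i W = window W k i @ drop k (drop i W)"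
    by (simp add: window_def del: drop_drop)
  then show ?case
    by (intro exI[of _ "[drop i W]"]) auto
next
  case (Suc m)
  then obtain j where j: "i + k \<le> j" "window W k i \<succ> window W k j" "descent m j"
    by auto
  from Suc.IH[OF j(3)] obtain us s where us: "length us = Suc m" "drop j W = concat us"
      "successively (\<succ>) us" "hd us = window W k j @ s"
    by auto
  define u where "u = take (j - i) (drop i W)"
  have split: "drop i W = u @ drop j W"
    unfolding u_def using append_take_drop_id[of "j - i" "drop i W"] j(1) by (simp add: add.commute)
  have u: "u = window W k i @ take (j - i - k) (drop k (drop i W))"
    using j(1) take_add[of k "j - i - k" "drop i W"] unfolding u_def window_def by simp
  have "u \<succ> hd us"
    unfolding u us(4) by (rule word_greater_append) (fact j(2))
  with us(1,3) have "successively (\<succ>) (u # us)"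
    by (cases us) auto
  moreover have "\<exists>s. u = window W k i @ s"
    using u by blast
  ultimately show ?case
    using us(1,2) split
    by (intro exI[of _ "u # us"]) auto
qed

lemma descent_decrease: "descent (m + d) i \<Longrightarrow> descent m i"
  by (induction m arbitrary: i) (auto intro: descent_starts)

lemma descent_bound:
  assumes "descent m i"
  shows "m < n - 1"
proof (rule ccontr)
  assume "\<not> m < n - 1"
  then have "descent (n - 1) i"
    using assms descent_decrease[of "n - 1" "m - (n - 1)" i] by simp
  from descent_division[OF this] obtain us
    where "length us = n" "drop i W = concat us" "successively (\<succ>) us"
    using n_pos by auto
  moreover have "W = take i W @ drop i W" by simp
  ultimately have "n_divisible n W"
    unfolding n_divisible_def by metis
  with indivisible show False by contradiction
qed

definition rank :: "nat \<Rightarrow> nat" where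
  "rank i = Max {m. descent m i}"

lemma finite_descents: "finite {m. descent m i}"
  by (rule finite_subset[of _ "{..<n - 1}"]) (auto dest: descent_bound)

lemma descent_rank: "i \<in> starts W k \<Longrightarrow> descent (rank i) i"
  using Max_in[OF finite_descents[of i]] by (auto simp: rank_def intro: descent.simps(1)[THEN iffD2])

lemma rank_less: "i \<in> starts W k \<Longrightarrow> rank i < n - 1"
  by (rule descent_bound[OF descent_rank])

text \<open>
  A longest chain from \<open>j\<close> can be prolonged by \<open>i\<close>. So positions of equal rank carry weakly
  increasing windows, provided that the windows are disjoint.
\<close>
lemma rank_decreases:
  assumes "i \<in> starts W k" "j \<in> starts W k" "i + k \<le> j" "window W k i \<succ> window W k j"
  shows "rank j < rank i"
proof -
  have "descent (Suc (rank j)) i"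
    using assms descent_rank by auto
  then have "Suc (rank j) \<le> rank i"
    unfolding rank_def[of i] by (intro Max_ge finite_descents) auto
  then show ?thesis by simp
qed

section \<open>Gaps with few windows\<close>

definition label :: "nat \<Rightarrow> nat \<times> 'a list" where
  "label i = (rank i, window W k i)"

definition occurrences :: "nat \<times> 'a list \<Rightarrow> nat set" where
  "occurrences c = {i \<in> starts W k. label i = c}"

text \<open>
  Positions of equal rank are comparable only if their windows are disjoint. So a position is
  useful when its window is disjoint from the first and from the last window with the same label;
  the fringe collects the starts of windows for which this may fail.
\<close>
definition fringe :: "nat set" where
  "fringe = (\<Union>c \<in> label ` starts W k.
     {Min (occurrences c)..<Min (occurrences c) + k} \<union>
     {Suc (Max (occurrences c)) - k..Max (occurrences c)})"

lemma finite_fringe [simp]: "finite fringe"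
  by (simp add: fringe_def)

lemma card_fringe: "card fringe \<le> 2 * k * (n - 1) * complexity W k"
proof -
  have "label ` starts W k \<subseteq> {..<n - 1} \<times> window W k ` starts W k"
    using rank_less by (auto simp: label_def)
  then have "card (label ` starts W k) \<le> card ({..<n - 1} \<times> window W k ` starts W k)"
    by (intro card_mono) auto
  then have labels: "card (label ` starts W k) \<le> (n - 1) * complexity W k"
    by (simp add: complexity_def card_cartesian_product)
  have "card fringe \<le> (\<Sum>c \<in> label ` starts W k.
     card ({Min (occurrences c)..<Min (occurrences c) + k} \<union>
     {Suc (Max (occurrences c)) - k..Max (occurrences c)}))"
    unfolding fringe_def by (rule card_UN_le) simp
  also have "\<dots> \<le> (\<Sum>c \<in> label ` starts W k. 2 * k)"
    by (intro sum_mono order_trans[OF card_Un_le]) auto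
  also have "\<dots> = card (label ` starts W k) * (2 * k)"
    by simp
  also have "\<dots> \<le> ((n - 1) * complexity W k) * (2 * k)"
    by (intro mult_right_mono labels) simp
  finally show ?thesis by (simp add: mult_ac)
qed

text \<open>
  Let \<open>a\<close> and \<open>b\<close> be the first and last position with the label of \<open>i\<close>. Outside the fringe, \<open>i\<close>
  is at distance at least \<open>k\<close> from both, and an interval from \<open>i\<close> that avoids the fringe cannot
  come closer to \<open>b\<close>. Then the window at \<open>j\<close> is squeezed between the equal windows at \<open>a\<close> and
  \<open>b\<close> by the monotonicity within a rank.
\<close>
lemma window_eq_in_gap:
  assumes "i \<le> j" "j \<in> starts W k" "{i..j} \<inter> fringe = {}" "rank i = rank j"
  shows "window W k i = window W k j"
proof -
  define c where "c = label i"
  define a where "a = Min (occurrences c)"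
  define b where "b = Max (occurrences c)"
  have i: "i \<in> starts W k"
    using assms(1,2) by (auto simp: starts_def)
  then have c: "c \<in> label ` starts W k" and occ: "i \<in> occurrences c"
    by (auto simp: c_def occurrences_def)
  have fin: "finite (occurrences c)"
    by (simp add: occurrences_def)
  have ne: "occurrences c \<noteq> {}"
    using occ by auto
  have ab: "a \<in> occurrences c" "b \<in> occurrences c" "a \<le> i" "i \<le> b"
    using fin occ Min_in[OF fin ne] Max_in[OF fin ne] by (auto simp: a_def b_def)
  then have a: "a \<in> starts W k" "rank a = rank j" "window W k a = window W k i"
    and b: "b \<in> starts W k" "rank b = rank j" "window W k b = window W k i"
    using assms(4) by (auto simp: occurrences_def c_def label_def)
  have sub: "{a..<a + k} \<subseteq> fringe" "{Suc b - k..b} \<subseteq> fringe"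
    using c unfolding fringe_def a_def b_def by blast+
  have "i \<notin> fringe" using assms(1,3) by auto
  with sub ab have far: "a + k \<le> i" "i + k \<le> b"
    by (auto simp: subset_iff)
  have "j + k \<le> b"
  proof (rule ccontr)
    assume "\<not> j + k \<le> b"
    \<comment> \<open>The interval would have to pass the left end of the fringe before \<open>b\<close>.\<close>
    with far have "Suc b - k \<in> {i..j}" by auto
    moreover have "Suc b - k \<in> fringe" using sub(2) k_pos by auto
    ultimately show False using assms(3) by blast
  qed
  with a far assms(1,2) have "\<not> window W k i \<succ> window W k j"
    using rank_decreases[of a j] by auto
  moreover from \<open>j + k \<le> b\<close> b assms(2) have "\<not> window W k j \<succ> window W k i"
    using rank_decreases[of j b] by auto
  ultimately show ?thesis
    using word_greater_total length_window[OF i] length_window[OF assms(2)] by metis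
qed

lemma card_windows_gap:
  assumes "j + k \<le> length W + 1" "{i..<j} \<inter> fringe = {}"
  shows "card (window W k ` {i..<j}) \<le> n - 1"
proof -
  have eq: "window W k x = window W k y"
    if "x \<in> {i..<j}" "y \<in> {i..<j}" "x \<le> y" "rank x = rank y" for x y
  proof (rule window_eq_in_gap)
    have "{x..y} \<subseteq> {i..<j}" using that by auto
    then show "{x..y} \<inter> fringe = {}" using assms(2) by blast
  qed (use that assms(1) in \<open>auto simp: starts_def\<close>)
  have "card (window W k ` {i..<j}) \<le> card (rank ` {i..<j})"
    using finite_atLeastLessThan eq by (rule card_image_le_card_key)
  also have "\<dots> \<le> card {..<n - 1}"
    using assms(1) by (intro card_mono) (auto intro!: rank_less[simplified] simp: starts_def)
  finally show ?thesis by simp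
qed

section \<open>Doubling the window length\<close>

text \<open>
  The number of gaps is at most \<open>card fringe + 1\<close>, and a gap contributes at most one window of
  length \<open>2 * k\<close> for each pair of ranks.
\<close>
lemma complexity_double:
  "complexity W (2 * k) \<le> (card fringe + 1) * (n - 1)\<^sup>2 + (k + 1) * card fringe"
proof -
  \<comment> \<open>Windows of length \<open>2 * k\<close> whose two halves do not start in a common gap are counted by position,
     the others by the pair of ranks and the gap, which \<open>card (fringe \<inter> {..<i})\<close> identifies.\<close>
  define near where "near = (\<Union>b \<in> fringe. {b - k..b})"
  define good where "good = {i \<in> starts W (2 * k). {i..i + k} \<inter> fringe = {}}"
  define key where "key i = (card (fringe \<inter> {..<i}), rank i, rank (i + k))" for i
  have st: "i \<in> starts W k" "i + k \<in> starts W k" if "i \<in> good" for i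
    using that by (auto simp: good_def starts_def)
  have cover: "starts W (2 * k) \<subseteq> good \<union> near"
    by (fastforce simp: good_def near_def)
  have near: "card near \<le> (k + 1) * card fringe"
  proof -
    have "card near \<le> (\<Sum>b \<in> fringe. card {b - k..b})"
      unfolding near_def by (rule card_UN_le) simp
    also have "\<dots> \<le> (\<Sum>b \<in> fringe. k + 1)"
      by (rule sum_mono) auto
    finally show ?thesis by (simp add: mult.commute)
  qed
  have ordered: "window W (2 * k) i = window W (2 * k) j"
    if "i \<in> good" "j \<in> good" "key i = key j" "i \<le> j" for i j
  proof -
    have "fringe \<inter> {..<i} = fringe \<inter> {..<j}"
      using that by (intro card_subset_eq) (auto simp: key_def)
    then have "x < i" if "x \<in> fringe" "x < j" for x
      using that by auto
    moreover have "\<not> (j \<le> x \<and> x \<le> j + k)" if "x \<in> fringe" for x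
      using that \<open>j \<in> good\<close> by (auto simp: good_def)
    ultimately have "{i..j + k} \<inter> fringe = {}"
      by (auto simp: disjoint_iff) (meson not_less)
    then have "{i..j} \<inter> fringe = {}" "{i + k..j + k} \<inter> fringe = {}"
      by (auto simp: disjoint_iff)
    then have "window W k i = window W k j" "window W k (i + k) = window W k (j + k)"
      using that st by (auto intro!: window_eq_in_gap simp: key_def)
    then show ?thesis
      using window_add[of W k k] by (simp add: mult_2)
  qed
  let ?keys = "{..card fringe} \<times> {..<n - 1} \<times> {..<n - 1}"
  have fin: "finite good" "finite near"
    by (auto simp: good_def near_def)
  have "card (window W (2 * k) ` good) \<le> card (key ` good)"
    using fin(1) ordered by (rule card_image_le_card_key)
  also have "\<dots> \<le> card ?keys"
    using st by (intro card_mono) (auto simp: key_def intro!: rank_less[simplified] card_mono)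
  also have "\<dots> = (card fringe + 1) * (n - 1)\<^sup>2"
    by (simp add: power2_eq_square)
  finally have good: "card (window W (2 * k) ` good) \<le> (card fringe + 1) * (n - 1)\<^sup>2" .
  have "complexity W (2 * k) \<le> card (window W (2 * k) ` good \<union> window W (2 * k) ` near)"
    unfolding complexity_def using cover fin by (intro card_mono) auto
  also have "\<dots> \<le> card (window W (2 * k) ` good) + card (window W (2 * k) ` near)"
    by (rule card_Un_le)
  also have "\<dots> \<le> (card fringe + 1) * (n - 1)\<^sup>2 + (k + 1) * card fringe"
    using good near card_image_le[OF fin(2), of "window W (2 * k)"] by linarith
  finally show ?thesis .
qed

end

lemma complexity_one:
  assumes "W \<in> lists A" "finite A"
  shows "complexity W 1 \<le> card A"
proof -
  have "window W 1 ` starts W 1 \<subseteq> (\<lambda>a. [a]) ` A"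
    using assms(1) by (fastforce simp: window_def starts_def take_Suc hd_drop_conv_nth)
  then show ?thesis
    unfolding complexity_def using assms(2) by (rule surj_card_le[rotated])
qed

text \<open>
  If \<open>d \<ge> 1\<close> bounds the complexity for \<open>k \<le> n\<close>, then \<open>card fringe + 1 \<le> 2 * n\<^sup>2 * d\<close>, and
  \<open>4 * n ^ 4 * d\<close> bounds the complexity for \<open>2 * k\<close>. The constant is absorbed by \<open>n\<^sup>2 \<ge> 4\<close>, which keeps the bound a pure power of
  \<open>n\<close>.
\<close>
lemma complexity_power_two:
  fixes W :: "'a::linorder list"
  assumes "\<not> n_divisible n W" "2 \<le> n" "W \<in> lists A" "finite A" "A \<noteq> {}"
    and "\<And>i. i < m \<Longrightarrow> 2 ^ i \<le> n"
  shows "complexity W (2 ^ m) \<le> card A * n ^ (6 * m)"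
  using assms(6)
proof (induction m)
  case 0
  then show ?case using complexity_one[OF assms(3,4)] by simp
next
  case (Suc m)
  define k :: nat where "k = 2 ^ m"
  define d where "d = card A * n ^ (6 * m)"
  interpret indivisible_word W n k
    using assms(1,2) by unfold_locales (auto simp: k_def)
  have k: "0 < k" "k \<le> n" using Suc.prems by (auto simp: k_def)
  have d: "complexity W k \<le> d" "1 \<le> d"
    using Suc assms(2,4,5) by (auto simp: k_def d_def Suc_le_eq card_gt_0_iff)
  have "card fringe \<le> 2 * k * (n - 1) * d"
    using card_fringe d(1) by (meson mult_le_mono2 order_trans)
  also have "\<dots> + 1 \<le> 2 * k * (n - 1) * d + 2 * k * d"
    using k d by (simp add: Suc_le_eq)
  also have "\<dots> = 2 * k * n * d"
    using assms(2) by (cases n) (auto simp: algebra_simps)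
  also have "\<dots> \<le> 2 * n * n * d"
    using k by simp
  finally have fringe: "card fringe + 1 \<le> 2 * n\<^sup>2 * d"
    by (simp add: power2_eq_square)
  have "complexity W (2 * k) \<le> (card fringe + 1) * (n - 1)\<^sup>2 + (k + 1) * card fringe"
    by (rule complexity_double)
  also have "\<dots> \<le> (card fringe + 1) * n\<^sup>2 + (2 * n) * (card fringe + 1)"
    using k assms(2) by (intro add_mono mult_mono power_mono) auto
  also have "\<dots> \<le> (2 * n\<^sup>2 * d) * n\<^sup>2 + (2 * n) * (2 * n\<^sup>2 * d)"
    using fringe by (intro add_mono mult_mono) auto
  also have "\<dots> = 2 * n ^ 4 * d + 2 * (2 * n ^ 3 * d)"
    by (simp add: algebra_simps power_numeral_reduce)
  also have "\<dots> \<le> 2 * n ^ 4 * d + 2 * (n * n ^ 3 * d)"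
    using assms(2) by simp
  also have "\<dots> = 4 * n ^ 4 * d"
    by (simp add: algebra_simps power_numeral_reduce)
  also have "\<dots> \<le> n\<^sup>2 * n ^ 4 * d"
    using power_mono[OF assms(2), of 2] by (intro mult_right_mono) auto
  also have "\<dots> = card A * n ^ (6 * Suc m)"
    by (simp add: d_def power_add power_numeral_reduce)
  finally show ?case by (simp add: k_def)
qed

section \<open>Few windows force a short period\<close>

text \<open>
  A finite form of the Morse--Hedlund theorem. The number of windows of length \<open>j\<close> starting below
  \<open>N\<close> is \<open>1\<close> for \<open>j = 0\<close> and at most \<open>q \<le> k\<close> for \<open>j = k\<close>, so it fails to grow from some \<open>j < k\<close> to
  \<open>j + 1\<close>. For this \<open>j\<close> a window determines the letter that follows, hence also the next window:
  once two windows of length \<open>j\<close> agree, the word repeats. By the pigeonhole principle this happens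
  among the first \<open>q + 1\<close> positions.
\<close>
lemma few_windows_imp_periodic:
  assumes "0 < N" "N + k \<le> length U + 1" "card (window U k ` {..<N}) \<le> q" "q \<le> k"
  shows "\<exists>s p. 0 < p \<and> s + p \<le> q \<and> (\<forall>x \<ge> s. x + p < N \<longrightarrow> U ! x = U ! (x + p))"
proof -
  let ?P = "\<lambda>j. window U j ` {..<N}"
  have take: "window U j x = take j (window U m x)" if "j \<le> m" for j m x
    using that by (simp add: window_def min_def)
  have img: "?P j = take j ` ?P m" if "j \<le> m" for j m
    by (simp add: image_image flip: take[OF that])
  have le_q: "card (?P j) \<le> q" if "j \<le> k" for j
    using assms(3) card_image_le[of "?P k" "take j"] img[OF that] by simp
  have "\<exists>j<k. card (?P (Suc j)) \<le> card (?P j)"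
  proof (rule ccontr)
    assume "\<not> ?thesis"
    then have step: "card (?P j) < card (?P (Suc j))" if "j < k" for j
      using that by auto
    have "Suc j \<le> card (?P j)" if "j \<le> k" for j
      using that
    proof (induction j)
      case 0
      have "?P 0 = {[]}" using assms(1) by (auto simp: window_def)
      then show ?case by simp
    next
      case (Suc j)
      then show ?case using step[of j] by simp
    qed
    from this[of k] le_q[of k] assms(4) show False by simp
  qed
  then obtain j where j: "j < k" "card (?P (Suc j)) \<le> card (?P j)" by auto
  have "card (take j ` ?P (Suc j)) = card (?P (Suc j))"
    using j(2) card_image_le[of "?P (Suc j)" "take j"] img[of j "Suc j"] by simp
  then have inj: "inj_on (take j) (?P (Suc j))"
    by (intro eq_card_imp_inj_on) auto
  have ext: "window U (Suc j) x = window U (Suc j) y"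
    if "x < N" "y < N" "window U j x = window U j y" for x y
    using inj_onD[OF inj, of "window U (Suc j) x" "window U (Suc j) y"] that take[of j "Suc j"] by simp
  have hd_eq: "U ! x = window U (Suc j) x ! 0" if "x < N" for x
    using that assms(2) j(1) by (simp add: window_def)
  have shift: "window U j (Suc x) = drop 1 (window U (Suc j) x)" for x
    by (simp add: window_def drop_take)
  show ?thesis
  proof (cases "q < N")
    case False
    moreover have "0 < q"
      using le_q[of 0] assms(1) by (cases q) (auto simp: lessThan_empty_iff)
    ultimately show ?thesis
      \<comment> \<open>With at most \<open>q\<close> positions, no position is constrained after a preperiod \<open>q - 1\<close>.\<close>
      by (intro exI[of _ "q - 1"] exI[of _ 1]) auto
  next
    case True
    have "window U j ` {..q} \<subseteq> ?P j" using True by auto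
    then have "card (window U j ` {..q}) \<le> q"
      using le_q[of j] j(1) by (meson card_mono finite_imageI finite_lessThan le_trans less_imp_le)
    then have "\<not> inj_on (window U j) {..q}"
      by (auto dest!: card_image)
    then obtain x y where "x \<le> q" "y \<le> q" "x \<noteq> y" "window U j x = window U j y"
      by (auto simp: inj_on_def)
    then obtain s t where st: "s < t" "t \<le> q" "window U j s = window U j t"
      by (metis linorder_neq_iff)
    define p where "p = t - s"
    have per: "s + d + p < N \<Longrightarrow> window U j (s + d) = window U j (s + d + p)" for d
    proof (induction d)
      case 0
      then show ?case using st by (simp add: p_def)
    next
      case (Suc d)
      then have "window U (Suc j) (s + d) = window U (Suc j) (s + d + p)"
        by (intro ext) auto
      then show ?case using shift[of "s + d"] shift[of "s + d + p"] by simp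
    qed
    have "U ! x = U ! (x + p)" if "s \<le> x" "x + p < N" for x
      using that per[of "x - s"] ext[of x "x + p"] hd_eq[of x] hd_eq[of "x + p"] by simp
    then show ?thesis
      using st by (intro exI[of _ s] exI[of _ p]) (auto simp: p_def)
  qed
qed

lemma periodic_word_decomposition:
  assumes "0 < p" "\<And>x. x + p < length V \<Longrightarrow> V ! x = V ! (x + p)"
  shows "\<exists>m r. V = word_power (take p V) m @ r \<and> length r < p"
  using assms(2)
proof (induction "length V" arbitrary: V rule: less_induct)
  case less
  show ?case
  proof (cases "length V < p")
    case True
    then show ?thesis
      by (intro exI[of _ 0] exI[of _ V]) (simp add: word_power_def)
  next
    case False
    have shifted: "drop p V ! x = drop p V ! (x + p)" if "x + p < length (drop p V)" for x
      using that less.prems[of "p + x"] by (simp add: add_ac)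
    have "length (drop p V) < length V"
      using False assms(1) by auto
    from less.hyps[OF this shifted] obtain m r
      where mr: "drop p V = word_power (take p (drop p V)) m @ r" "length r < p" by auto
    show ?thesis
    proof (cases "length (drop p V) < p")
      case True
      then show ?thesis
        by (intro exI[of _ 1] exI[of _ "drop p V"]) (simp add: word_power_def)
    next
      case False
      then have "take p (drop p V) = take p V"
        using less.prems by (intro nth_equalityI) (auto simp: add.commute)
      then have "V = take p V @ word_power (take p V) m @ r"
        using mr(1) append_take_drop_id[of p V] by simp
      then show ?thesis
        using mr(2) by (intro exI[of _ "Suc m"] exI[of _ r]) (simp add: word_power_def)
    qed
  qed
qed

section \<open>Assembling a representation\<close>

lemma representable_append:
  assumes "representable Y h U" "representable Y h' V"
  shows "representable Y (h + h') (U @ V)"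
proof -
  obtain ps where "length ps \<le> h" "\<forall>(u, k) \<in> set ps. u \<in> Y"
      "U = concat (map (\<lambda>(u, k). word_power u k) ps)"
    using assms(1) unfolding representable_def by auto
  moreover obtain qs where "length qs \<le> h'" "\<forall>(u, k) \<in> set qs. u \<in> Y"
      "V = concat (map (\<lambda>(u, k). word_power u k) qs)"
    using assms(2) unfolding representable_def by auto
  ultimately show ?thesis
    unfolding representable_def by (intro exI[of _ "ps @ qs"]) auto
qed

lemma representable_mono: "representable Y h U \<Longrightarrow> h \<le> h' \<Longrightarrow> representable Y h' U"
  unfolding representable_def by (elim exE conjE, intro exI conjI) auto

lemma representable_word_power: "u \<in> Y \<Longrightarrow> representable Y 1 (word_power u m)"
  unfolding representable_def by (intro exI[of _ "[(u, m)]"]) auto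

lemma representable_letters:
  "(\<And>x. x \<in> set U \<Longrightarrow> [x] \<in> Y) \<Longrightarrow> representable Y (length U) U"
proof (induction U)
  case Nil
  then show ?case by (auto simp: representable_def intro: exI[of _ "[]"])
next
  case (Cons x U)
  then have "representable Y 1 [x]"
    using representable_word_power[of "[x]" Y 1] by (simp add: word_power_def)
  with Cons show ?case
    using representable_append[of Y 1 "[x]" "length U" U] by simp
qed

text \<open>
  The preperiod \<open>s\<close> and a remainder shorter than the period \<open>p\<close> are spelled letter by letter; with
  the single power between them this makes at most \<open>s + 1 + (p - 1) \<le> q\<close> factors.
\<close>
lemma representable_few_windows:
  assumes "N + k \<le> length U + 1" "card (window U k ` {..<N}) \<le> q" "q \<le> k"
    and Y: "\<And>u. set u \<subseteq> set U \<Longrightarrow> length u \<le> q \<Longrightarrow> u \<in> Y"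
  shows "representable Y q (take N U)"
proof (cases "N = 0")
  case True
  then show ?thesis by (auto simp: representable_def intro: exI[of _ "[]"])
next
  case False
  then obtain s p where sp: "0 < p" "s + p \<le> q"
      "\<And>x. s \<le> x \<Longrightarrow> x + p < N \<Longrightarrow> U ! x = U ! (x + p)"
    using few_windows_imp_periodic[OF _ assms(1-3)] by blast
  have letter: "[x] \<in> Y" if "x \<in> set U" for x
    using that sp(1,2) by (intro Y) auto
  define S V where "S = take s (take N U)" and "V = drop s (take N U)"
  have sub: "set S \<subseteq> set U" "set V \<subseteq> set U"
    unfolding S_def V_def by (meson set_take_subset set_drop_subset subset_trans)+
  have "V ! x = V ! (x + p)" if "x + p < length V" for x
  proof -
    have "s \<le> length (take N U)" using that by (auto simp: V_def)
    then show ?thesis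
      using that sp(3)[of "s + x"] by (simp add: V_def add_ac)
  qed
  from periodic_word_decomposition[OF sp(1) this] obtain m r
    where mr: "V = word_power (take p V) m @ r" "length r < p" by auto
  have "representable Y (length S) S"
    using sub letter by (intro representable_letters) auto
  moreover have "representable Y 1 (word_power (take p V) m)"
    using sub(2) sp(2) set_take_subset[of p V] by (intro representable_word_power Y) auto
  moreover have "representable Y (length r) r"
  proof (rule representable_letters)
    fix x assume "x \<in> set r"
    then have "x \<in> set V" by (subst mr(1)) simp
    then show "[x] \<in> Y" using sub letter by auto
  qed
  ultimately have "representable Y (length S + (1 + length r)) (S @ word_power (take p V) m @ r)"
    by (intro representable_append)
  moreover have "S @ word_power (take p V) m @ r = take N U"
    unfolding mr(1)[symmetric] unfolding S_def V_def by (rule append_take_drop_id)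
  moreover have "length S \<le> s" by (simp add: S_def)
  then have "length S + (1 + length r) \<le> q" using sp(2) mr(2) by linarith
  ultimately show ?thesis by (metis representable_mono)
qed

text \<open>
  Every element of \<open>B\<close> contributes its own letter, and the gap after it at most \<open>h\<close> factors; one more
  gap precedes the first element.
\<close>
lemma representable_gaps:
  assumes gap: "\<And>i j. i \<le> j \<Longrightarrow> j \<le> N \<Longrightarrow> {i..<j} \<inter> B = {} \<Longrightarrow>
                  representable Y h (take (j - i) (drop i W))"
    and letter: "\<And>x. x \<in> set W \<Longrightarrow> [x] \<in> Y"
    and "N \<le> length W"
  shows "representable Y ((card (B \<inter> {..<N}) + 1) * (h + 1)) (take N W)"
  using assms(1,3)
proof (induction N rule: less_induct)
  case (less N)
  show ?case
  proof (cases "B \<inter> {..<N} = {}")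
    case True
    then have "representable Y h (take N W)"
      using less.prems(1)[of 0 N] by (auto simp: lessThan_atLeast0 Int_commute)
    then show ?thesis using True by (auto intro: representable_mono)
  next
    case False
    define b where "b = Max (B \<inter> {..<N})"
    have "b \<in> B \<inter> {..<N}" unfolding b_def using False by (intro Max_in) auto
    then have b: "b \<in> B" "b < N" by auto
    have max: "x \<le> b" if "x \<in> B" "x < N" for x
      using that unfolding b_def by (intro Max_ge) auto
    have "B \<inter> {..<N} = insert b (B \<inter> {..<b})"
      using b max by (auto simp: order_le_less)
    then have card: "card (B \<inter> {..<N}) = Suc (card (B \<inter> {..<b}))" by simp
    have "representable Y ((card (B \<inter> {..<b}) + 1) * (h + 1)) (take b W)"
      using b(2) less.prems by (intro less.IH) auto
    moreover have "representable Y 1 [W ! b]"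
      using representable_letters[of "[W ! b]" Y] letter b(2) less.prems(2) by simp
    moreover have "representable Y h (take (N - Suc b) (drop (Suc b) W))"
      using b(2) max by (intro less.prems(1)) fastforce+
    ultimately have "representable Y ((card (B \<inter> {..<b}) + 1) * (h + 1) + (1 + h))
        (take b W @ [W ! b] @ take (N - Suc b) (drop (Suc b) W))"
      by (intro representable_append)
    moreover have "take N W = take b W @ [W ! b] @ take (N - Suc b) (drop (Suc b) W)"
      using b(2) less.prems(2) take_add[of "Suc b" "N - Suc b" W] by (simp add: take_Suc_conv_app_nth)
    ultimately show ?thesis by (simp add: card add_ac)
  qed
qed

text \<open>
  Only positions where a full window starts have a rank, so the fewer than \<open>k\<close> letters at the
  end are added separately.
\<close>
lemma (in indivisible_word) representable_by_fringe:
  assumes "2 \<le> n" "n \<le> k" "W \<in> lists A"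
  shows "representable {u \<in> lists A. length u < n} ((card fringe + 1) * n + k) W"
proof -
  let ?Y = "{u \<in> lists A. length u < n}"
  define N where "N = length W + 1 - k"
  have N: "N \<le> length W" using k_pos by (simp add: N_def)
  have letter: "[x] \<in> ?Y" if "x \<in> set W" for x
    using that assms(1,3) by auto
  have "representable ?Y (n - 1) (take (j - i) (drop i W))"
    if ij: "i \<le> j" "j \<le> N" "{i..<j} \<inter> fringe = {}" for i j
  proof (cases "i = j")
    case True
    then show ?thesis by (auto simp: representable_def intro: exI[of _ "[]"])
  next
    case False
    then have len: "j + k \<le> length W + 1" using ij by (simp add: N_def)
    show ?thesis
    proof (rule representable_few_windows[where k = k])
      show "j - i + k \<le> length (drop i W) + 1" using len ij(1) by simp
      have "window (drop i W) k ` {..<j - i} = window W k ` (\<lambda>x. x + i) ` {..<j - i}"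
        by (simp add: image_image window_def)
      also have "(\<lambda>x. x + i) ` {..<j - i} = {i..<j}"
        using ij(1) by (simp add: lessThan_atLeast0 image_add_atLeastLessThan' del: image_add_atLeastLessThan)
      finally show "card (window (drop i W) k ` {..<j - i}) \<le> n - 1"
        using card_windows_gap[OF len ij(3)] by simp
      show "n - 1 \<le> k" using assms(2) by simp
      show "u \<in> ?Y" if "set u \<subseteq> set (drop i W)" "length u \<le> n - 1" for u
        using that assms(1,3) set_drop_subset[of i W] by fastforce
    qed
  qed
  then have "representable ?Y ((card (fringe \<inter> {..<N}) + 1) * (n - 1 + 1)) (take N W)"
    using letter N by (intro representable_gaps) auto
  moreover have "representable ?Y (length (drop N W)) (drop N W)"
    using letter set_drop_subset[of N W] by (intro representable_letters) blast
  ultimately have "representable ?Y ((card (fringe \<inter> {..<N}) + 1) * (n - 1 + 1) + length (drop N W)) (take N W @ drop N W)"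
    by (rule representable_append)
  moreover have "(card (fringe \<inter> {..<N}) + 1) * (n - 1 + 1) + length (drop N W) \<le> (card fringe + 1) * n + k"
    using n_pos by (intro add_mono mult_mono) (auto simp: N_def intro: card_mono)
  ultimately show ?thesis by (auto intro: representable_mono)
qed

section \<open>The height bound\<close>

text \<open>
  For the least \<open>m\<close> with \<open>n \<le> 2 ^ m\<close> the window length \<open>k = 2 ^ m\<close> is long enough for gaps to be
  periodic, and at most \<open>2 * n\<close>, so that \<open>(card fringe + 1) * n + k\<close> is at most \<open>8 * n ^ 3\<close> times the
  complexity bound.
\<close>
lemma representable_indivisible:
  fixes A :: "'a::linorder set"
  assumes "2 \<le> n" "finite A" "A \<noteq> {}" "W \<in> lists A" "\<not> n_divisible n W"
    and m: "n \<le> 2 ^ m" "\<And>i. i < m \<Longrightarrow> 2 ^ i < n"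
  shows "representable {u \<in> lists A. length u < n} (card A * n ^ (6 * m + 6)) W"
proof -
  define k :: nat where "k = 2 ^ m"
  define d where "d = card A * n ^ (6 * m)"
  interpret indivisible_word W n k
    using assms by unfold_locales (auto simp: k_def)
  have d: "complexity W k \<le> d" "1 \<le> d"
    using complexity_power_two[OF assms(5,1,4,2,3), of m] m(2) assms(1-3)
    by (auto simp: k_def d_def Suc_le_eq card_gt_0_iff intro: less_imp_le)
  have "k \<le> 2 * n"
    using m(2)[of "m - 1"] assms(1) by (cases m) (auto simp: k_def)
  have "card fringe \<le> 2 * k * (n - 1) * d"
    using card_fringe d(1) by (meson mult_le_mono2 order_trans)
  also have "\<dots> + 1 \<le> 2 * k * (n - 1) * d + 2 * k * d"
    using k_pos d by (simp add: Suc_le_eq)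
  also have "\<dots> = 2 * k * n * d"
    using assms(1) by (cases n) (auto simp: algebra_simps)
  also have "\<dots> \<le> 2 * (2 * n) * n * d"
    using \<open>k \<le> 2 * n\<close> by (intro mult_right_mono) auto
  finally have "(card fringe + 1) * n + k \<le> (2 * (2 * n) * n * d) * n + (2 * n) * 1"
    using \<open>k \<le> 2 * n\<close> by (intro add_mono mult_right_mono) auto
  also have "\<dots> \<le> (2 * (2 * n) * n * d) * n + (2 * n) * (n * n * d)"
    using d(2) assms(1) by (intro add_mono mult_left_mono) (auto simp: Suc_le_eq)
  also have "\<dots> \<le> 2 ^ 3 * n ^ 3 * d"
    by (simp add: power_numeral_reduce algebra_simps)
  also have "\<dots> \<le> n ^ 3 * n ^ 3 * d"
    using assms(1) by (intro mult_right_mono power_mono) auto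
  also have "\<dots> = card A * n ^ (6 * m + 6)"
    by (simp add: d_def power_add power_numeral_reduce)
  finally have "(card fringe + 1) * n + k \<le> card A * n ^ (6 * m + 6)" .
  moreover have "n \<le> k"
    using m(1) by (simp add: k_def)
  ultimately show ?thesis
    by (intro representable_mono[OF representable_by_fringe[OF assms(1) _ assms(4)]])
qed

lemma has_height_exists:
  assumes "\<And>W. W \<in> M \<Longrightarrow> representable Y H W"
  shows "\<exists>h \<le> H. has_height M Y h"
proof -
  let ?P = "\<lambda>h. \<forall>W \<in> M. representable Y h W"
  have "?P H" using assms by blast
  then have "has_height M Y (Least ?P)" "Least ?P \<le> H"
    unfolding has_height_def using LeastI[of ?P H] Least_le[of ?P] by blast+
  then show ?thesis by blast
qed

lemma \<Phi>_lower_bound: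
  assumes "2 \<le> n" "real m \<le> log 2 (real n) + 1"
  shows "real (l * n ^ (6 * m + 6)) \<le> \<Phi> n l"
proof -
  have n: "1 \<le> real n" "0 < real n" using assms(1) by auto
  then have "0 \<le> log 2 (real n)" by simp
  with assms(2) have "real (6 * m + 6) \<le> 38 + 8 * log 2 (real n)" by simp
  then have "real n ^ (6 * m + 6) \<le> real n powr (38 + 8 * log 2 (real n))"
    using n by (subst powr_realpow[symmetric]) (auto intro: powr_mono)
  then have "1 * real l * real n ^ (6 * m + 6) \<le> 2 ^ 40 * real l * real n powr (38 + 8 * log 2 (real n))"
    by (intro mult_mono) auto
  then show ?thesis by (simp add: \<Phi>_def)
qed

theorem theorem9:
  fixes A :: "'a::linorder set" and n l :: nat
  assumes "n > 0" and "l > 0"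
    and "finite A" and "card A = l"
  shows "\<exists>h. has_height {W \<in> lists A. \<not> n_divisible n W} {u \<in> lists A. length u < n} h
             \<and> real h \<le> \<Phi> n l"
proof (cases "n = 1")
  case True
  have "n_divisible 1 W" for W :: "'a list"
    unfolding n_divisible_def by (intro exI[of _ "[]"] exI[of _ "[W]"]) simp
  then have "\<exists>h \<le> 0. has_height {W \<in> lists A. \<not> n_divisible n W} {u \<in> lists A. length u < n} h"
    using True by (intro has_height_exists) auto
  then show ?thesis by (auto simp: \<Phi>_def)
next
  case False
  with assms(1) have n: "2 \<le> n" by simp
  define m where "m = (LEAST m. n \<le> 2 ^ m)"
  have m: "n \<le> 2 ^ m"
    unfolding m_def by (rule LeastI[of _ n]) (simp add: less_imp_le)
  have below: "2 ^ i < n" if "i < m" for i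
    using that not_less_Least[of i "\<lambda>m. n \<le> 2 ^ m"] unfolding m_def by simp
  have "real m \<le> log 2 (real n) + 1"
  proof (cases m)
    case 0
    then show ?thesis using n by simp
  next
    case (Suc i)
    then have "real (2 ^ i) < real n" using below[of i] by (simp only: of_nat_less_iff)
    then have "real i < log 2 (real n)" using n by (simp add: less_log_iff powr_realpow)
    then show ?thesis using Suc by simp
  qed
  moreover have "\<exists>h \<le> card A * n ^ (6 * m + 6).
      has_height {W \<in> lists A. \<not> n_divisible n W} {u \<in> lists A. length u < n} h"
    using n m below assms by (intro has_height_exists representable_indivisible) auto
  ultimately show ?thesis
    using \<Phi>_lower_bound[OF n] assms(4) by (meson of_nat_le_iff order_trans)
qed

end
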